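(* For every $n\geq 0$, the bijection $\phi:\mathcal{D}_n^{h,\geq}\to\mathcal{M}_n$ satisfies, for every $P\in\mathcal{D}_n^{h,\geq}$, $$\#UD(P)=\#F(\phi(P))+\#UD(\phi(P)),$$ $$\#UU(P)=\#DD(P)=\#U(\phi(P))+\#UU(\phi(P))+\#UF(\phi(P)),$$ $$\#DU(P)=\#FF(\phi(P))+\#FU(\phi(P))+\#DF(\phi(P))+\#DU(\phi(P)).$$
   Context: A Motzkin path of length $n$ is a word in the steps $U=(1,1)$, $D=(1,-1)$, $F=(1,0)$ forming a lattice path from $(0,0)$ to $(n,0)$ that never goes below the $x$-axis; $\mathcal{M}_n$ is the set of Motzkin paths of length $n$. A Dyck path of semilength $n$ is a Motzkin path of length $2n$ with no $F$ steps. Every nonempty Dyck path $P$ has a unique first return decomposition $P=U\alpha D\beta$ with $\alpha,\beta$ Dyck paths. Let $h(P)$ denote the maximal height of a Dyck path. The set $\mathcal{D}^{h,\geq}$ is defined recursively: it contains the empty path $\epsilon$, and a nonempty Dyck path $P=U\alpha D\beta$ (first return decomposition) belongs to $\mathcal{D}^{h,\geq}$ iff $\alpha,\beta\in\mathcal{D}^{h,\geq}$ and $h(U\alpha D)\geq h(\beta)$. $\mathcal{D}_n^{h,\geq}$ is the set of its elements of semilength $n$. The bijection $\phi:\mathcal{D}_n^{h,\geq}\to\mathcal{M}_n$ is defined recursively by $\phi(\epsilon)=\epsilon$; $\phi(\alpha UD)=\phi(\alpha)F$; and $\phi(\alpha UU\beta D\gamma D)=\phi(\alpha)\phi(\gamma)U\phi(\beta)D$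 (where $\alpha,\beta,\gamma$ are Dyck paths). For a word $X$ in the steps, $\#X(P)$ denotes the number of occurrences of $X$ as a factor (consecutive steps) of the path $P$. *)

theory Defs
  imports Main
begin

datatype step = U | D | F

text \<open>Every step advances one unit to the right, so a path is determined by its word of steps,
  its horizontal extent is the length of that word, and only the vertical coordinate has to be
  tracked.\<close>

fun rise :: "step \<Rightarrow> int" where
  "rise U = 1"
| "rise D = -1"
| "rise F = 0"

definition elevation :: "step list \<Rightarrow> int" where
  "elevation w = (\<Sum>s\<leftarrow>w. rise s)"

definition motzkin :: "step list \<Rightarrow> bool" where
  "motzkin w \<longleftrightarrow> elevation w = 0 \<and> (\<forall>k\<le>length w. 0 \<le> elevation (take k w))"

definition dyck :: "step list \<Rightarrow> bool" where
  "dyck w \<longleftrightarrow> motzkin w \<and> F \<notin> set w"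

definition max_height :: "step list \<Rightarrow> int" where
  "max_height w = Max ((\<lambda>k. elevation (take k w)) ` {..length w})"

text \<open>The first return decomposition is unique (see \<open>first_return_unique\<close>), so the rule
  \<open>first_return\<close> is an equivalence for nonempty Dyck paths.\<close>

inductive_set dyck_h_ge :: "step list set" where
  empty: "[] \<in> dyck_h_ge"
| first_return:
    "\<lbrakk>dyck \<alpha>; dyck \<beta>; \<alpha> \<in> dyck_h_ge; \<beta> \<in> dyck_h_ge;
      max_height ([U] @ \<alpha> @ [D]) \<ge> max_height \<beta>\<rbrakk>
     \<Longrightarrow> [U] @ \<alpha> @ [D] @ \<beta> \<in> dyck_h_ge"

definition motzkin_paths :: "nat \<Rightarrow> step list set" where
  "motzkin_paths n = {w. motzkin w \<and> length w = n}"

definition dyck_h_ge_paths :: "nat \<Rightarrow> step list set" where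
  "dyck_h_ge_paths n = {w \<in> dyck_h_ge. length w = 2 * n}"

text \<open>The number of occurrences of a word as a factor; overlapping occurrences count separately.\<close>

definition occ :: "step list \<Rightarrow> step list \<Rightarrow> nat" where
  "occ X w = card {(u, v). w = u @ X @ v}"

lemma elevation_simps [simp]:
  "elevation [] = 0" "elevation (s # w) = rise s + elevation w"
  "elevation (u @ v) = elevation u + elevation v"
  by (simp_all add: elevation_def)

lemma dyck_elevation: "dyck w \<Longrightarrow> elevation w = 0"
  by (simp add: dyck_def motzkin_def)

lemma dyck_iff:
  "dyck w \<longleftrightarrow> elevation w = 0 \<and> (\<forall>k. 0 \<le> elevation (take k w)) \<and> F \<notin> set w"
  unfolding dyck_def motzkin_def by (metis nat_le_linear order_refl take_all_iff)

lemma dyck_prefix: "dyck (u @ v) \<Longrightarrow> 0 \<le> elevation u"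
  unfolding dyck_iff by (metis append_eq_conv_conj)

lemma dyckI:
  assumes "elevation w = 0" "\<And>u v. w = u @ v \<Longrightarrow> 0 \<le> elevation u" "F \<notin> set w"
  shows "dyck w"
  unfolding dyck_iff using assms by (metis append_take_drop_id)

lemma dyck_Nil [simp]: "dyck []"
  by (simp add: dyck_iff)

lemma dyck_append:
  assumes "dyck u" "dyck v"
  shows "dyck (u @ v)"
  using assms by (auto simp: dyck_iff)

lemma dyck_wrap:
  assumes "dyck u"
  shows "dyck (U # u @ [D])"
proof -
  have "0 \<le> elevation (take k (U # u @ [D]))" for k
  proof (cases k)
    case (Suc m)
    have "0 \<le> elevation (take m u)" "elevation u = 0"
      using assms by (auto simp: dyck_iff)
    moreover have "-1 \<le> elevation (take (m - length u) [D])"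
      by (cases "m - length u") auto
    ultimately show ?thesis
      using Suc by simp
  qed simp
  then show ?thesis
    using assms by (auto simp: dyck_iff)
qed

lemma first_return_unique:
  assumes "dyck a" "dyck a'" "a @ D # b = a' @ D # b'"
  shows "a = a'" "b = b'"
proof -
  have *: "\<not> (\<exists>c. u = w @ D # c)" if "dyck u" "dyck w" for u w
  proof
    assume "\<exists>c. u = w @ D # c"
    then obtain c where "u = (w @ [D]) @ c" by auto
    with \<open>dyck u\<close> have "0 \<le> elevation (w @ [D])" using dyck_prefix by metis
    with \<open>dyck w\<close> show False by (simp add: dyck_elevation)
  qed
  from assms(3) show "a = a'" "b = b'"
    using *[OF assms(1,2)] *[OF assms(2,1)]
    by (auto simp: append_eq_append_conv2 append_eq_Cons_conv Cons_eq_append_conv)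
qed

lemma last_return_unique:
  assumes "dyck a" "dyck a'" "dyck b" "dyck b'" "a @ U # b = a' @ U # b'"
  shows "a = a'" "b = b'"
proof -
  have *: "\<not> (u = w @ U # c \<and> x = c @ U # y)" if "dyck u" "dyck w" "dyck x" for u w c x y
  proof
    assume ux: "u = w @ U # c \<and> x = c @ U # y"
    then have "0 \<le> elevation c" using that(3) dyck_prefix by blast
    moreover have "elevation u = elevation w + 1 + elevation c" using ux by simp
    ultimately show False using that(1,2) by (simp add: dyck_elevation)
  qed
  from assms(5) show "a = a'" "b = b'"
    using *[OF assms(1,2,4)] *[OF assms(2,1,3)]
    by (auto simp: append_eq_append_conv2 append_eq_Cons_conv Cons_eq_append_conv)
qed

lemma dyck_first_return:
  assumes "dyck w" "w \<noteq> []"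
  obtains a b where "dyck a" "dyck b" "w = U # a @ D # b"
proof -
  obtain s v where w: "w = s # v" using \<open>w \<noteq> []\<close> by (cases w) auto
  have "0 \<le> elevation [s]" using dyck_prefix[of "[s]" v] assms w by simp
  moreover have "s \<noteq> F" using assms w by (auto simp: dyck_iff)
  ultimately have s: "s = U" by (cases s) auto
  have ev: "elevation v = -1" using assms w s by (auto dest: dyck_elevation)
  define k where "k = (LEAST k. elevation (take k v) < 0)"
  have k: "elevation (take k v) < 0"
    unfolding k_def by (rule LeastI[of _ "length v"]) (simp add: ev)
  have least: "0 \<le> elevation (take j v)" if "j < k" for j
    using not_less_Least[of j "\<lambda>k. elevation (take k v) < 0"] that unfolding k_def by force
  obtain j where j: "k = Suc j" using k by (cases k) auto
  have "j < length v"
    using k least[of j] j by (metis leI le_SucI lessI not_less take_all)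
  then have tk: "take k v = take j v @ [v ! j]" by (simp add: j take_Suc_conv_app_nth)
  have 0: "0 \<le> elevation (take j v)" using least j by simp
  have vj: "v ! j = D" using k 0 unfolding tk by (cases "v ! j") auto
  have e: "elevation (take j v) = 0" using k 0 unfolding tk vj by simp
  define b where "b = drop (Suc j) v"
  have v: "v = take j v @ D # b"
    using \<open>j < length v\<close> vj unfolding b_def by (metis id_take_nth_drop)
  have wF: "F \<notin> set v" using assms w by (auto simp: dyck_iff)
  have "dyck (take j v)"
  proof -
    have "0 \<le> elevation (take i (take j v))" for i
      using least[of "min i j"] j by simp
    then show ?thesis using e wF by (auto simp: dyck_iff dest: in_set_takeD)
  qed
  moreover have "dyck b"
  proof (rule dyckI)
    have "elevation v = elevation (take j v @ D # b)" using v by simp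
    then show "elevation b = 0" using ev e by simp
    show "F \<notin> set b" using wF by (auto simp: b_def dest: in_set_dropD)
    fix x y assume "b = x @ y"
    then have "w = (U # take j v @ D # x) @ y" using w s v by simp
    then have "0 \<le> elevation (U # take j v @ D # x)" using assms(1) dyck_prefix by metis
    then show "0 \<le> elevation x" using e by simp
  qed
  ultimately show thesis using that w s v by blast
qed

lemma dyck_last_return:
  assumes "dyck w" "w \<noteq> []"
  obtains a b where "dyck a" "dyck b" "w = a @ U # b @ [D]"
  using assms
proof (induction "length w" arbitrary: w thesis rule: less_induct)
  case less
  obtain a b where ab: "dyck a" "dyck b" "w = U # a @ D # b"
    using dyck_first_return less.prems by metis
  show ?case
  proof (cases "b = []")
    case True
    then show ?thesis using ab less.prems(1)[of "[]" a] by simp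
  next
    case False
    obtain c d where cd: "dyck c" "dyck d" "b = c @ U # d @ [D]"
      using less.hyps[of b] ab False by auto
    have "dyck ((U # a @ [D]) @ c)" using ab cd by (intro dyck_append dyck_wrap)
    then show ?thesis using ab cd less.prems(1)[of "(U # a @ [D]) @ c" d] by simp
  qed
qed

lemma dyck_cases:
  assumes "dyck w"
  obtains "w = []"
  | \<alpha> where "dyck \<alpha>" "w = \<alpha> @ [U, D]"
  | \<alpha> \<beta> \<gamma> where "dyck \<alpha>" "dyck \<beta>" "dyck \<gamma>" "w = \<alpha> @ [U, U] @ \<beta> @ [D] @ \<gamma> @ [D]"
proof (cases "w = []")
  case False
  obtain a b where ab: "dyck a" "dyck b" "w = a @ U # b @ [D]"
    using dyck_last_return assms False by metis
  show thesis
  proof (cases "b = []")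
    case True
    then show thesis using ab that(2) by simp
  next
    case False
    obtain c d where "dyck c" "dyck d" "b = U # c @ D # d"
      using dyck_first_return ab False by metis
    then show thesis using ab that(3)[of a c d] by simp
  qed
qed (rule that(1))

lemma dyck_UD: "dyck \<alpha> \<Longrightarrow> dyck (\<alpha> @ [U, D])"
  using dyck_append[OF _ dyck_wrap[OF dyck_Nil]] by simp

lemma dyck_UUDD:
  assumes "dyck \<alpha>" "dyck \<beta>" "dyck \<gamma>"
  shows "dyck (U # \<beta> @ D # \<gamma>)" "dyck (\<alpha> @ [U, U] @ \<beta> @ [D] @ \<gamma> @ [D])"
proof -
  show *: "dyck (U # \<beta> @ D # \<gamma>)"
    using dyck_append[OF dyck_wrap[OF assms(2)] assms(3)] by simp
  show "dyck (\<alpha> @ [U, U] @ \<beta> @ [D] @ \<gamma> @ [D])"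
    using dyck_append[OF assms(1) dyck_wrap[OF *]] by simp
qed

lemma UD_unique:
  assumes "dyck a" "dyck a'" "a @ [U, D] = a' @ [U, D]"
  shows "a = a'"
  using assms by simp

lemma UUDD_unique:
  assumes "dyck a" "dyck b" "dyck c" "dyck a'" "dyck b'" "dyck c'"
    and "a @ [U, U] @ b @ [D] @ c @ [D] = a' @ [U, U] @ b' @ [D] @ c' @ [D]"
  shows "a = a' \<and> b = b' \<and> c = c'"
proof -
  have eq: "a @ U # (U # b @ D # c) = a' @ U # (U # b' @ D # c')"
    using assms(7) by (metis append.assoc append_Cons append_Nil butlast_snoc)
  note * = last_return_unique[OF assms(1,4) dyck_UUDD(1)[OF assms(1-3)] dyck_UUDD(1)[OF assms(4-6)] eq]
  then have "b @ D # c = b' @ D # c'" by simp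
  from * first_return_unique[OF assms(2,5) this] show ?thesis by simp
qed

lemma UD_neq_UUDD:
  assumes "dyck a" "dyck a'" "dyck b'" "dyck c'"
  shows "a @ [U, D] \<noteq> a' @ [U, U] @ b' @ [D] @ c' @ [D]"
proof
  assume "a @ [U, D] = a' @ [U, U] @ b' @ [D] @ c' @ [D]"
  then have "a @ U # [] = a' @ U # (U # b' @ D # c')"
    by (metis append.assoc append_Cons append_Nil butlast_snoc)
  from last_return_unique(2)[OF assms(1,2) dyck_Nil dyck_UUDD(1)[OF assms(2-4)] this]
  show False by simp
qed

text \<open>The recursion makes sense on all Dyck paths; the value on other words is irrelevant.\<close>

function \<phi> :: "step list \<Rightarrow> step list" where
  "\<phi> [] = []"
| "dyck \<alpha> \<Longrightarrow> \<phi> (\<alpha> @ [U, D]) = \<phi> \<alpha> @ [F]"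
| "dyck \<alpha> \<Longrightarrow> dyck \<beta> \<Longrightarrow> dyck \<gamma> \<Longrightarrow>
     \<phi> (\<alpha> @ [U, U] @ \<beta> @ [D] @ \<gamma> @ [D]) = \<phi> \<alpha> @ \<phi> \<gamma> @ [U] @ \<phi> \<beta> @ [D]"
| "\<not> dyck w \<Longrightarrow> \<phi> w = undefined"
proof goal_cases
  case (1 P x)
  then show ?case by (cases "dyck x") (auto elim: dyck_cases)
next
  case (6 a a') then show ?case using UD_unique by blast
next
  case (7 a a' b' c') then show ?case using UD_neq_UUDD by blast
next
  case (9 a b c a' b' c') then show ?case using UUDD_unique by metis
qed (use dyck_UD dyck_UUDD in auto)
termination by (relation "measure length") auto

end

theory Submission
  imports Defs
begin

text \<open>On Dyck paths \<open>\<phi>\<close> is multiplicative, so with \<open>P = \<alpha>UU\<beta>D\<gamma>D\<close> we get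
  \<open>\<phi> P = \<phi> (\<alpha>\<gamma>) U \<phi> \<beta> D\<close>. The last return decomposition of \<open>\<phi> P\<close> therefore determines
  \<open>\<phi> (\<alpha>\<gamma>)\<close> and \<open>\<phi> \<beta>\<close>, hence inductively \<open>\<alpha>\<gamma>\<close> and \<open>\<beta>\<close>. A path is in \<open>dyck_h_ge\<close> iff the
  heights of its prime components weakly decrease and their interiors are in \<open>dyck_h_ge\<close>; for
  \<open>P\<close> this says that \<open>\<alpha>\<gamma>\<close> and \<open>\<beta>\<close> are in \<open>dyck_h_ge\<close>, the components of \<open>\<alpha>\<close> have height at
  least \<open>h \<beta> + 2\<close>, and those of \<open>\<gamma>\<close> have smaller height. So \<open>\<alpha>\<close> and \<open>\<gamma>\<close> are recovered by
  cutting \<open>\<alpha>\<gamma>\<close> at the threshold \<open>h \<beta> + 2\<close>. The equations between the statistics hold for all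
  Dyck paths, by induction along the recursion of \<open>\<phi>\<close>.\<close>

section \<open>Factor counts\<close>

lemma occ_Nil: "X \<noteq> [] \<Longrightarrow> occ X [] = 0"
  by (simp add: occ_def)

text \<open>A factorization is determined by the length of \<open>u\<close>. Finiteness matters
  because \<open>occ\<close> is a cardinality, and \<open>card\<close> returns 0 on infinite
  sets.\<close>

lemma finite_factorizations: "finite {(u, v). w = u @ X @ v}"
proof (rule finite_surj)
  show "{(u, v). w = u @ X @ v} \<subseteq> (\<lambda>i. (take i w, drop (i + length X) w)) ` {..length w}"
  proof
    fix p
    assume "p \<in> {(u, v). w = u @ X @ v}"
    then obtain u v where "p = (u, v)" "w = u @ X @ v" by blast
    then show "p \<in> (\<lambda>i. (take i w, drop (i + length X) w)) ` {..length w}"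
      by (intro image_eqI[of _ _ "length u"]) simp_all
  qed
qed simp

text \<open>The factorizations with empty \<open>u\<close> give at most one occurrence, at the
  front; those with nonempty \<open>u\<close> correspond to the factorizations of \<open>w\<close>
  by dropping \<open>s\<close>.\<close>

lemma occ_Cons:
  "occ X (s # w) = (if take (length X) (s # w) = X then 1 else 0) + occ X w"
proof -
  let ?A = "{(u, v). u = [] \<and> s # w = X @ v}"
  let ?B = "(\<lambda>(u, v). (s # u, v)) ` {(u, v). w = u @ X @ v}"
  have eq: "{(u, v). s # w = u @ X @ v} = ?A \<union> ?B"
    by (auto simp: Cons_eq_append_conv image_iff)
  have A: "?A = (if take (length X) (s # w) = X then {([], drop (length X) (s # w))} else {})"
    using append_take_drop_id[of "length X" "s # w"]
    by (cases "take (length X) (s # w) = X"; force)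
  have "card ?A = (if take (length X) (s # w) = X then 1 else 0)" "finite ?A"
    unfolding A by simp_all
  moreover have "card ?B = occ X w"
    unfolding occ_def by (rule card_image) (auto simp: inj_on_def)
  moreover have "?A \<inter> ?B = {}" by auto
  ultimately show ?thesis
    using finite_factorizations[of w X] unfolding occ_def eq
    by (subst card_Un_disjoint) (auto simp: occ_def)
qed

lemma occ1_append: "occ [x] (u @ v) = occ [x] u + occ [x] v"
  by (induction u) (simp_all add: occ_Nil occ_Cons)

lemma occ1_Cons: "occ [x] (s # w) = (if s = x then 1 else 0) + occ [x] w"
  by (simp add: occ_Cons)

lemma occ2_Cons:
  "occ [x, y] (s # w) = (if s = x \<and> w \<noteq> [] \<and> hd w = y then 1 else 0) + occ [x, y] w"
  by (cases w) (simp_all add: occ_Cons)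

lemma occ2_append:
  "occ [x, y] (u @ v) = occ [x, y] u + occ [x, y] v +
     (if u \<noteq> [] \<and> v \<noteq> [] \<and> last u = x \<and> hd v = y then 1 else 0)"
  by (induction u) (auto simp: occ_Nil occ2_Cons)

lemmas occ_simps = occ_Nil occ1_Cons occ1_append occ2_Cons occ2_append

section \<open>Motzkin paths\<close>

text \<open>Separated from the condition of returning to the axis, because prefixes of Motzkin paths
  may end at positive height.\<close>

definition nonneg :: "step list \<Rightarrow> bool" where
  "nonneg w \<longleftrightarrow> (\<forall>k. 0 \<le> elevation (take k w))"

lemma motzkin_iff: "motzkin w \<longleftrightarrow> elevation w = 0 \<and> nonneg w"
  unfolding motzkin_def nonneg_def by (metis nat_le_linear order_refl take_all_iff)

lemma nonneg_Nil [simp]: "nonneg []"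
  by (simp add: nonneg_def)

lemma nonneg_prefix: "nonneg (u @ v) \<Longrightarrow> nonneg u"
  unfolding nonneg_def by (metis append_eq_conv_conj take_take)

lemma nonneg_elevation: "nonneg w \<Longrightarrow> 0 \<le> elevation w"
  unfolding nonneg_def by (metis order_refl take_all)

lemma nonneg_append: "nonneg u \<Longrightarrow> nonneg v \<Longrightarrow> nonneg (u @ v)"
  using nonneg_elevation[of u]
  by (auto simp: nonneg_def)

lemma nonneg_snoc: "nonneg (w @ [s]) \<longleftrightarrow> nonneg w \<and> 0 \<le> elevation (w @ [s])"
proof
  assume *: "nonneg w \<and> 0 \<le> elevation (w @ [s])"
  have "0 \<le> elevation (take k (w @ [s]))" for k
  proof (cases "k \<le> length w")
    case True
    then show ?thesis using * by (simp add: nonneg_def)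
  next
    case False
    then have "take k (w @ [s]) = w @ [s]" by simp
    then show ?thesis using * by metis
  qed
  then show "nonneg (w @ [s])" unfolding nonneg_def by blast
qed (use nonneg_prefix nonneg_elevation in blast)

lemma nonneg_U [simp]: "nonneg [U]"
  using nonneg_snoc[of "[]" U] by simp

lemma motzkin_Nil [simp]: "motzkin []"
  by (simp add: motzkin_iff)

lemma motzkin_append: "motzkin u \<Longrightarrow> motzkin v \<Longrightarrow> motzkin (u @ v)"
  by (simp add: motzkin_iff nonneg_append)

lemma motzkin_snoc_F [simp]: "motzkin (w @ [F]) \<longleftrightarrow> motzkin w"
  by (auto simp: motzkin_iff nonneg_snoc)

section \<open>Last return decomposition of Motzkin paths\<close>

lemma motzkin_last_return:
  assumes "motzkin a" "motzkin b"
  shows "motzkin (a @ U # b @ [D])"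
proof -
  have "nonneg (a @ [U] @ b)"
    using assms by (intro nonneg_append) (auto simp: motzkin_iff)
  then show ?thesis
    using assms nonneg_snoc[of "a @ [U] @ b" D] by (simp add: motzkin_iff)
qed

text \<open>If the two marked \<open>U\<close> steps differed, the later one would be preceded by
  the earlier \<open>U\<close> and a prefix \<open>c\<close> of a Motzkin path. The left part ending
  there would then have height at least 1 instead of 0.\<close>

lemma motzkin_last_return_unique:
  assumes "motzkin a" "motzkin a'" "motzkin b" "motzkin b'" "a @ U # b = a' @ U # b'"
  shows "a = a'" "b = b'"
proof -
  have *: "\<not> (u = w @ U # c \<and> x = c @ U # y)" if "motzkin u" "motzkin w" "motzkin x" for u w c x y
  proof
    assume ux: "u = w @ U # c \<and> x = c @ U # y"
    then have "0 \<le> elevation c"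
      using that(3) nonneg_prefix nonneg_elevation unfolding motzkin_iff by blast
    moreover have "elevation u = elevation w + 1 + elevation c" using ux by simp
    ultimately show False using that(1,2) by (simp add: motzkin_iff)
  qed
  from assms(5) show "a = a'" "b = b'"
    using *[OF assms(1,2,4)] *[OF assms(2,1,3)]
    by (auto simp: append_eq_append_conv2 append_eq_Cons_conv Cons_eq_append_conv)
qed

text \<open>The marked \<open>U\<close> is the last step leaving height
  \<open>elevation w - 1\<close>, after which the path stays at or above its final height.\<close>

lemma nonneg_last_ascent:
  assumes "nonneg w" "1 \<le> elevation w"
  obtains a b where "w = a @ U # b" "nonneg a" "motzkin b"
  using assms
proof (induction "length w" arbitrary: w thesis rule: less_induct)
  case less
  obtain v s where w: "w = v @ [s]"
    using less.prems(3) by (cases w rule: rev_cases) auto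
  have v: "nonneg v" using less.prems(2) w nonneg_prefix by blast
  show ?case
  proof (cases s)
    case U
    then show ?thesis using less.prems(1)[of v "[]"] w v by simp
  next
    case F
    then have "1 \<le> elevation v" using less.prems(3) w by simp
    then obtain a b where "v = a @ U # b" "nonneg a" "motzkin b"
      using less.hyps[of v] v w by auto
    then show ?thesis using less.prems(1)[of a "b @ [F]"] w F by simp
  next
    \<comment> \<open>Before a final \<open>D\<close> the path is one unit higher, so two ascents
      are peeled off: the inner one is matched by this \<open>D\<close>, the outer one is the ascent
      sought.\<close>
    case D
    then have ev: "2 \<le> elevation v" using less.prems(3) w by simp
    then obtain a b where ab: "v = a @ U # b" "nonneg a" "motzkin b"
      using less.hyps[of v] v w by auto
    then have "1 \<le> elevation a" using ev by (simp add: motzkin_iff)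
    then obtain c d where "a = c @ U # d" "nonneg c" "motzkin d"
      using less.hyps[of a] ab w by auto
    then show ?thesis
      using less.prems(1)[of c "d @ U # b @ [D]"] ab w D motzkin_last_return by simp
  qed
qed

lemma motzkin_cases:
  assumes "motzkin w"
  obtains "w = []"
  | v where "motzkin v" "w = v @ [F]"
  | a b where "motzkin a" "motzkin b" "w = a @ U # b @ [D]"
proof (cases w rule: rev_cases)
  case (snoc v s)
  show thesis
  proof (cases s)
    case U
    then have "elevation v = -1" using assms snoc by (simp add: motzkin_iff)
    then show thesis
      using assms snoc nonneg_prefix nonneg_elevation[of v] unfolding motzkin_iff by force
  next
    case D
    then have "nonneg v" "elevation v = 1"
      using assms snoc nonneg_prefix by (auto simp: motzkin_iff)
    then obtain a b where ab: "v = a @ U # b" "nonneg a" "motzkin b"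
      using nonneg_last_ascent[of v] by auto
    then have "motzkin a" using \<open>elevation v = 1\<close> by (simp add: motzkin_iff)
    then show thesis using that(3) ab snoc D by simp
  next
    case F
    then show thesis using that(2) assms snoc by simp
  qed
qed (rule that(1))

lemma motzkin_hd: "motzkin w \<Longrightarrow> w \<noteq> [] \<Longrightarrow> hd w \<noteq> D"
  using nonneg_elevation[of "[hd w]"] nonneg_prefix[of "[hd w]" "tl w"]
  by (cases w) (auto simp: motzkin_iff)

lemma motzkin_last: "motzkin w \<Longrightarrow> w \<noteq> [] \<Longrightarrow> last w \<noteq> U"
  by (erule motzkin_cases) auto

section \<open>Statistics under \<open>\<phi>\<close>\<close>

text \<open>Induction along the recursion of \<open>\<phi>\<close>, restricted to its meaningful
  arguments.\<close>

lemma dyck_induct [consumes 1, case_names Nil UD UUDD]: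
  assumes "dyck w" "P []"
    and "\<And>\<alpha>. dyck \<alpha> \<Longrightarrow> P \<alpha> \<Longrightarrow> P (\<alpha> @ [U, D])"
    and "\<And>\<alpha> \<beta> \<gamma>. dyck \<alpha> \<Longrightarrow> dyck \<beta> \<Longrightarrow> dyck \<gamma> \<Longrightarrow> P \<alpha> \<Longrightarrow> P \<beta> \<Longrightarrow> P \<gamma> \<Longrightarrow>
      P (\<alpha> @ [U, U] @ \<beta> @ [D] @ \<gamma> @ [D])"
  shows "P w"
  using assms(1)
proof (induction "length w" arbitrary: w rule: less_induct)
  case less
  from less.prems show ?case
    by (cases rule: dyck_cases) (use assms(2-) less.hyps in auto)
qed

lemma dyck_hd_last:
  assumes "dyck w" "w \<noteq> []"
  shows "hd w = U" "last w = D"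
  by (rule dyck_first_return[OF assms], simp) (rule dyck_last_return[OF assms], simp)

text \<open>Both recursive clauses of \<open>\<phi>\<close> take apart only the last prime component
  and leave a Dyck prefix, so \<open>u\<close> is carried along in that prefix.\<close>

lemma \<phi>_append:
  assumes "dyck u" "dyck v"
  shows "\<phi> (u @ v) = \<phi> u @ \<phi> v"
  using assms(2)
proof (induction v rule: dyck_induct)
  case (UD \<alpha>)
  then show ?case
    using \<phi>.simps(2)[OF dyck_append[OF assms(1)], of \<alpha>] by simp
next
  case (UUDD \<alpha> \<beta> \<gamma>)
  then show ?case
    using \<phi>.simps(3)[OF dyck_append[OF assms(1)], of \<alpha> \<beta> \<gamma>] \<phi>.simps(3)[of \<alpha> \<beta> \<gamma>] by simp
qed simp

lemma motzkin_\<phi>: "dyck w \<Longrightarrow> motzkin (\<phi> w)"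
proof (induction w rule: dyck_induct)
  case (UUDD \<alpha> \<beta> \<gamma>)
  then show ?case
    using motzkin_last_return[of "\<phi> \<alpha> @ \<phi> \<gamma>" "\<phi> \<beta>"] motzkin_append
    by (simp only: \<phi>.simps) simp
qed simp_all

lemma length_\<phi>: "dyck w \<Longrightarrow> 2 * length (\<phi> w) = length w"
proof (induction w rule: dyck_induct)
  case (UUDD \<alpha> \<beta> \<gamma>)
  then show ?case by (simp only: \<phi>.simps) simp
qed simp_all

lemma \<phi>_eq_Nil_iff: "dyck w \<Longrightarrow> \<phi> w = [] \<longleftrightarrow> w = []"
  using length_\<phi>[of w] by auto

text \<open>In each clause of \<open>\<phi>\<close> the pieces contribute by induction, so only the
  inserted steps and the junctions remain. These depend only on which pieces are empty and on their
  end letters, which leaves a finite case check.\<close>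

lemma occ_\<phi>:
  assumes "dyck w"
  shows "occ [U, D] w = occ [F] (\<phi> w) + occ [U, D] (\<phi> w)"
    and "occ [U, U] w = occ [D, D] w"
    and "occ [D, D] w = occ [U] (\<phi> w) + occ [U, U] (\<phi> w) + occ [U, F] (\<phi> w)"
    and "occ [D, U] w = occ [F, F] (\<phi> w) + occ [F, U] (\<phi> w) + occ [D, F] (\<phi> w) + occ [D, U] (\<phi> w)"
proof -
  have ends: "x = [] \<and> \<phi> x = [] \<or> x \<noteq> [] \<and> \<phi> x \<noteq> [] \<and> hd x = U \<and> last x = D \<and>
      (hd (\<phi> x) = U \<or> hd (\<phi> x) = F) \<and> (last (\<phi> x) = D \<or> last (\<phi> x) = F)" if "dyck x" for x
    using \<phi>_eq_Nil_iff[OF that] dyck_hd_last[OF that] motzkin_last[OF motzkin_\<phi>[OF that]]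
      motzkin_hd[OF motzkin_\<phi>[OF that]]
    by (cases "hd (\<phi> x)"; cases "last (\<phi> x)") auto
  have "occ [U, D] w = occ [F] (\<phi> w) + occ [U, D] (\<phi> w) \<and>
    occ [U, U] w = occ [D, D] w \<and>
    occ [D, D] w = occ [U] (\<phi> w) + occ [U, U] (\<phi> w) + occ [U, F] (\<phi> w) \<and>
    occ [D, U] w = occ [F, F] (\<phi> w) + occ [F, U] (\<phi> w) + occ [D, F] (\<phi> w) + occ [D, U] (\<phi> w)"
    using assms
  proof (induction w rule: dyck_induct)
    case Nil
    show ?case by (simp add: occ_Nil)
  next
    case (UD \<alpha>)
    have "\<alpha> = [] \<or> \<phi> \<alpha> \<noteq> [] \<and> last \<alpha> = D \<and> (last (\<phi> \<alpha>) = D \<or> last (\<phi> \<alpha>) = F)"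
      using ends[OF UD.hyps] by blast
    then show ?case
      using UD by (auto simp: occ_simps)
  next
    case (UUDD \<alpha> \<beta> \<gamma>)
    \<comment> \<open>The cases are split by the letters met at junctions. The last letter of
      \<open>\<phi> \<alpha>\<close> separates \<open>DF\<close>, \<open>DU\<close> from
      \<open>FF\<close>, \<open>FU\<close>; the first letter of \<open>\<phi> \<beta>\<close>
      separates \<open>UU\<close> from \<open>UF\<close>. Of the factors ending in \<open>D\<close>
      only \<open>UD\<close> is counted in the image, so before the final \<open>D\<close> it
      suffices that \<open>\<phi> \<beta>\<close> does not end in \<open>U\<close>.\<close>
    have \<alpha>: "\<alpha> = [] \<and> \<phi> \<alpha> = [] \<or> \<alpha> \<noteq> [] \<and> \<phi> \<alpha> \<noteq> [] \<and> last \<alpha> = D \<and> last (\<phi> \<alpha>) = D \<or>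
        \<alpha> \<noteq> [] \<and> \<phi> \<alpha> \<noteq> [] \<and> last \<alpha> = D \<and> last (\<phi> \<alpha>) = F"
      using ends[OF UUDD.hyps(1)] by blast
    have \<beta>: "\<beta> = [] \<and> \<phi> \<beta> = [] \<or>
        \<beta> \<noteq> [] \<and> \<phi> \<beta> \<noteq> [] \<and> hd \<beta> = U \<and> last \<beta> = D \<and> hd (\<phi> \<beta>) = U \<and> last (\<phi> \<beta>) \<noteq> U \<or>
        \<beta> \<noteq> [] \<and> \<phi> \<beta> \<noteq> [] \<and> hd \<beta> = U \<and> last \<beta> = D \<and> hd (\<phi> \<beta>) = F \<and> last (\<phi> \<beta>) \<noteq> U"
      using ends[OF UUDD.hyps(2)] by auto
    show ?case
      unfolding \<phi>.simps(3)[OF UUDD.hyps]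
      using \<alpha> \<beta> ends[OF UUDD.hyps(3)] UUDD.IH
      by (elim disjE conjE; simp add: occ_simps)
  qed
  then show "occ [U, D] w = occ [F] (\<phi> w) + occ [U, D] (\<phi> w)"
    and "occ [U, U] w = occ [D, D] w"
    and "occ [D, D] w = occ [U] (\<phi> w) + occ [U, U] (\<phi> w) + occ [U, F] (\<phi> w)"
    and "occ [D, U] w = occ [F, F] (\<phi> w) + occ [F, U] (\<phi> w) + occ [D, F] (\<phi> w) + occ [D, U] (\<phi> w)"
    by simp_all
qed

section \<open>Heights of prime components\<close>

lemma max_height_Nil [simp]: "max_height [] = 0"
  by (simp add: max_height_def)

text \<open>The empty prefix contributes 0; every other prefix is \<open>s\<close> followed by a
  prefix of \<open>w\<close>, and \<open>Max\<close> commutes with the shift by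
  \<open>rise s\<close>.\<close>

lemma max_height_Cons: "max_height (s # w) = max 0 (rise s + max_height w)"
proof -
  let ?f = "\<lambda>k. elevation (take k w)"
  have "(\<lambda>k. elevation (take k (s # w))) ` {..length (s # w)} =
      insert 0 ((\<lambda>x. rise s + x) ` ?f ` {..length w})"
    by (auto simp: atMost_Suc_eq_insert_0 image_iff)
  moreover have "Max ((\<lambda>x. rise s + x) ` ?f ` {..length w}) = rise s + Max (?f ` {..length w})"
    by (rule mono_Max_commute[symmetric]) (auto simp: mono_def)
  ultimately show ?thesis
    unfolding max_height_def by (simp add: Max_insert)
qed

lemma max_height_nonneg: "0 \<le> max_height w"
  by (cases w) (simp_all add: max_height_Cons)

lemma max_height_append: "max_height (u @ v) = max (max_height u) (elevation u + max_height v)"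
  by (induction u) (auto simp: max_height_Cons max_height_nonneg)

lemma max_height_wrap: "dyck a \<Longrightarrow> max_height (U # a @ [D]) = max_height a + 1"
  using max_height_nonneg[of a] by (simp add: max_height_Cons max_height_append dyck_elevation)

lemma max_height_first_return:
  assumes "dyck a"
  shows "max_height (U # a @ D # b) = max (max_height a + 1) (max_height b)"
  using max_height_append[of "U # a @ [D]" b] max_height_wrap[OF assms] assms
  by (simp add: dyck_elevation)

text \<open>Iterated first returns cut a Dyck path into its prime components \<open>U a D\<close>,
  whose heights are \<open>max_height a + 1\<close>.\<close>

inductive prime_heights_ge :: "int \<Rightarrow> step list \<Rightarrow> bool" for t where
  Nil [simp, intro]: "prime_heights_ge t []"
| first_return: "dyck a \<Longrightarrow> dyck b \<Longrightarrow> t \<le> max_height a + 1 \<Longrightarrow> prime_heights_ge t b \<Longrightarrow>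
    prime_heights_ge t (U # a @ D # b)"

lemma prime_heights_ge_iff:
  assumes "dyck a" "dyck b"
  shows "prime_heights_ge t (U # a @ D # b) \<longleftrightarrow> t \<le> max_height a + 1 \<and> prime_heights_ge t b"
proof
  assume "prime_heights_ge t (U # a @ D # b)"
  then show "t \<le> max_height a + 1 \<and> prime_heights_ge t b"
  proof cases
    case (first_return a' b')
    then have "a = a'" "b = b'" using first_return_unique[of a a' b b'] assms by auto
    then show ?thesis using first_return by simp
  qed
qed (use assms prime_heights_ge.first_return in auto)

section \<open>Membership in \<open>dyck_h_ge\<close> in terms of component heights\<close>

lemma dyck_first_return_iff:
  assumes "dyck a"
  shows "dyck (U # a @ D # b) \<longleftrightarrow> dyck b"
proof
  assume "dyck (U # a @ D # b)"
  then obtain a' b' where "dyck a'" "dyck b'" "U # a @ D # b = U # a' @ D # b'"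
    by (rule dyck_first_return) simp_all
  then show "dyck b" using first_return_unique[of a a' b b'] assms by auto
qed (use dyck_append[OF dyck_wrap[OF assms], of b] in simp)

lemma dyck_h_ge_dyck: "w \<in> dyck_h_ge \<Longrightarrow> dyck w"
proof (induction rule: dyck_h_ge.induct)
  case (first_return \<alpha> \<beta>)
  then show ?case using dyck_first_return_iff by simp
qed simp

lemma dyck_h_ge_first_return_iff:
  assumes "dyck a" "dyck b"
  shows "U # a @ D # b \<in> dyck_h_ge \<longleftrightarrow>
    a \<in> dyck_h_ge \<and> b \<in> dyck_h_ge \<and> max_height b \<le> max_height a + 1"
proof
  assume "U # a @ D # b \<in> dyck_h_ge"
  then show "a \<in> dyck_h_ge \<and> b \<in> dyck_h_ge \<and> max_height b \<le> max_height a + 1"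
  proof cases
    case (first_return a' b')
    then have "a = a'" "b = b'" using first_return_unique[of a a' b b'] assms by auto
    then show ?thesis using first_return max_height_wrap[of a'] by simp
  qed
next
  assume "a \<in> dyck_h_ge \<and> b \<in> dyck_h_ge \<and> max_height b \<le> max_height a + 1"
  then show "U # a @ D # b \<in> dyck_h_ge"
    using dyck_h_ge.first_return[OF assms] max_height_wrap[OF assms(1)] by simp
qed

lemma dyck_first_return_induct [consumes 1, case_names Nil first_return]:
  assumes "dyck w" "P []"
    and "\<And>a b. dyck a \<Longrightarrow> dyck b \<Longrightarrow> P a \<Longrightarrow> P b \<Longrightarrow> P (U # a @ D # b)"
  shows "P w"
  using assms(1)
proof (induction "length w" arbitrary: w rule: less_induct)
  case less
  show ?case
  proof (cases "w = []")
    case False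
    with less.prems obtain a b where "dyck a" "dyck b" "w = U # a @ D # b"
      by (rule dyck_first_return)
    then show ?thesis using assms(3) less.hyps by simp
  qed (use assms(2) in simp)
qed

text \<open>Weak decrease across the junction means that every component of \<open>u\<close> is at
  least as high as the tallest one of \<open>v\<close>, whose height is
  \<open>max_height v\<close>.\<close>

lemma dyck_h_ge_append_iff:
  assumes "dyck u" "dyck v"
  shows "u @ v \<in> dyck_h_ge \<longleftrightarrow>
    u \<in> dyck_h_ge \<and> v \<in> dyck_h_ge \<and> prime_heights_ge (max_height v) u"
  using assms(1)
proof (induction u rule: dyck_first_return_induct)
  case (first_return a b)
  have "max_height (b @ v) = max (max_height b) (max_height v)"
    using first_return.hyps by (simp add: max_height_append dyck_elevation)
  then show ?case
    using first_return dyck_h_ge_first_return_iff[of a "b @ v"] dyck_append[OF _ assms(2)]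
    by (auto simp: dyck_h_ge_first_return_iff prime_heights_ge_iff)
qed (simp add: dyck_h_ge.empty)

lemma prime_heights_ge_antimono: "prime_heights_ge t w \<Longrightarrow> s \<le> t \<Longrightarrow> prime_heights_ge s w"
  by (induction rule: prime_heights_ge.induct) (auto intro: prime_heights_ge.first_return)

text \<open>Hence appending \<open>UD\<close>, a component of height 1, never breaks weak
  decrease.\<close>

lemma prime_heights_ge_one: "dyck w \<Longrightarrow> prime_heights_ge 1 w"
  by (induction rule: dyck_first_return_induct)
    (auto simp: prime_heights_ge_iff max_height_nonneg)

lemma dyck_h_ge_UD_iff:
  assumes "dyck \<alpha>"
  shows "\<alpha> @ [U, D] \<in> dyck_h_ge \<longleftrightarrow> \<alpha> \<in> dyck_h_ge"
  using dyck_h_ge_append_iff[OF assms dyck_wrap[OF dyck_Nil]] max_height_wrap[OF dyck_Nil]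
    dyck_h_ge_first_return_iff[of "[]" "[]"] prime_heights_ge_one[OF assms]
  by (simp add: dyck_h_ge.empty)

text \<open>This form depends on \<open>\<alpha>\<close> and \<open>\<gamma>\<close> only through
  \<open>\<alpha> @ \<gamma>\<close> and the position of the cut, which is all that
  \<open>\<phi>\<close> leaves to be recovered.\<close>

lemma dyck_h_ge_UUDD_iff:
  assumes "dyck \<alpha>" "dyck \<beta>" "dyck \<gamma>"
  shows "\<alpha> @ [U, U] @ \<beta> @ [D] @ \<gamma> @ [D] \<in> dyck_h_ge \<longleftrightarrow>
    \<alpha> @ \<gamma> \<in> dyck_h_ge \<and> \<beta> \<in> dyck_h_ge \<and>
    prime_heights_ge (max_height \<beta> + 2) \<alpha> \<and> max_height \<gamma> < max_height \<beta> + 2"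
proof -
  let ?q = "U # \<beta> @ D # \<gamma>"
  have q: "dyck ?q" using dyck_UUDD(1)[OF assms] .
  have wrap: "U # ?q @ [D] \<in> dyck_h_ge \<longleftrightarrow> ?q \<in> dyck_h_ge"
    using dyck_h_ge_first_return_iff[OF q dyck_Nil] max_height_nonneg[of ?q]
    by (simp add: dyck_h_ge.empty)
  have "\<alpha> @ (U # ?q @ [D]) \<in> dyck_h_ge \<longleftrightarrow>
      \<alpha> \<in> dyck_h_ge \<and> ?q \<in> dyck_h_ge \<and> prime_heights_ge (max_height ?q + 1) \<alpha>"
    unfolding dyck_h_ge_append_iff[OF assms(1) dyck_wrap[OF q]] wrap max_height_wrap[OF q] ..
  \<comment> \<open>The bound on \<open>\<gamma>\<close> makes the first component of
    \<open>?q\<close> its tallest, so \<open>max_height ?q + 1\<close> is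
    \<open>max_height \<beta> + 2\<close>.\<close>
  also have "\<dots> \<longleftrightarrow> \<alpha> \<in> dyck_h_ge \<and> \<beta> \<in> dyck_h_ge \<and> \<gamma> \<in> dyck_h_ge \<and>
      max_height \<gamma> \<le> max_height \<beta> + 1 \<and> prime_heights_ge (max_height \<beta> + 2) \<alpha>"
    using assms by (auto simp: dyck_h_ge_first_return_iff max_height_first_return max_def
      add.commute dest: antisym)
  \<comment> \<open>The components of \<open>\<alpha>\<close> exceed
    \<open>max_height \<gamma>\<close>, so joining \<open>\<alpha>\<close> and
    \<open>\<gamma>\<close> adds no condition.\<close>
  also have "\<dots> \<longleftrightarrow> \<alpha> @ \<gamma> \<in> dyck_h_ge \<and> \<beta> \<in> dyck_h_ge \<and>
      prime_heights_ge (max_height \<beta> + 2) \<alpha> \<and> max_height \<gamma> < max_height \<beta> + 2"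
    using prime_heights_ge_antimono[of "max_height \<beta> + 2" \<alpha> "max_height \<gamma>"]
    by (auto simp: dyck_h_ge_append_iff[OF assms(1,3)])
  finally show ?thesis by simp
qed

text \<open>Component heights weakly decrease, so those reaching \<open>t\<close> form a prefix.
  Positivity of \<open>t\<close> allows an empty low part, whose height is 0.\<close>

lemma threshold_split:
  assumes "dyck w" "w \<in> dyck_h_ge" "0 < t"
  obtains u v where "w = u @ v" "dyck u" "dyck v" "prime_heights_ge t u" "max_height v < t"
proof -
  have "\<exists>u v. w = u @ v \<and> dyck u \<and> dyck v \<and> prime_heights_ge t u \<and> max_height v < t"
    using assms(1,2)
  proof (induction w rule: dyck_first_return_induct)
    case Nil
    show ?case using assms(3) by (intro exI[of _ "[]"]) simp
  next
    case (first_return a b)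
    show ?case
    proof (cases "t \<le> max_height a + 1")
      case True
      obtain u v where "b = u @ v" "dyck u" "dyck v" "prime_heights_ge t u" "max_height v < t"
        using first_return dyck_h_ge_first_return_iff by blast
      then show ?thesis
        using True first_return.hyps
        by (intro exI[of _ "U # a @ D # u"] exI[of _ v])
          (simp add: prime_heights_ge_iff dyck_first_return_iff)
    next
      case False
      \<comment> \<open>Membership in \<open>dyck_h_ge\<close> makes the first component the
        tallest, so the whole remainder goes into the low part.\<close>
      then have "max_height (U # a @ D # b) < t"
        using first_return dyck_h_ge_first_return_iff by (simp add: max_height_first_return)
      then show ?thesis
        using first_return.hyps
        by (intro exI[of _ "[]"] exI[of _ "U # a @ D # b"]) (simp add: dyck_first_return_iff)
    qed
  qed
  then show thesis using that by blast
qed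

text \<open>Common first components are stripped one by one. If one high part ended before the
  other, its low part would begin with a component of height at least \<open>t\<close>.\<close>

lemma threshold_split_unique:
  assumes "prime_heights_ge t u" "max_height v < t"
    and "prime_heights_ge t u'" "max_height v' < t"
    and "u @ v = u' @ v'"
  shows "u = u' \<and> v = v'"
  using assms(1,3,5)
proof (induction arbitrary: u' rule: prime_heights_ge.induct)
  case Nil
  from Nil(1) show ?case
  proof cases
    case (first_return a b)
    then have "max_height v = max (max_height a + 1) (max_height (b @ v'))"
      using Nil max_height_first_return by simp
    then show ?thesis using first_return assms(2) by simp
  qed (use Nil in simp)
next
  case (first_return a b)
  from first_return.prems(1) show ?case
  proof cases
    case Nil
    then have "max_height v' = max (max_height a + 1) (max_height (b @ v))"
      using first_return max_height_first_return[of a "b @ v"] by auto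
    then show ?thesis using first_return assms(4) by simp
  next
    case (first_return a' b')
    then have "a @ D # (b @ v) = a' @ D # (b' @ v')" using first_return.prems by simp
    then have "a = a'" "b @ v = b' @ v'"
      using first_return_unique \<open>dyck a\<close> \<open>dyck a'\<close> by blast+
    then show ?thesis using first_return.IH[of b'] first_return by simp
  qed
qed

section \<open>Bijectivity\<close>

text \<open>The image is empty, ends in \<open>F\<close> or ends in \<open>D\<close> according to
  the clause of \<open>\<phi>\<close> used, so \<open>x\<close> and \<open>y\<close> fall under the
  same clause.\<close>

lemma inj_on_\<phi>: "inj_on \<phi> dyck_h_ge"
proof
  fix x y
  assume "x \<in> dyck_h_ge" "y \<in> dyck_h_ge" "\<phi> x = \<phi> y"
  then show "x = y"
  proof (induction "length x" arbitrary: x y rule: less_induct)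
    case less
    have "dyck x" "dyck y" using less.prems dyck_h_ge_dyck by auto
    from \<open>dyck x\<close> show ?case
    proof (cases rule: dyck_cases)
      case 1
      then show ?thesis using \<phi>_eq_Nil_iff[OF \<open>dyck y\<close>] less.prems(3) by simp
    next
      case x: (2 \<alpha>)
      from \<open>dyck y\<close> show ?thesis
      proof (cases rule: dyck_cases)
        case 1
        then show ?thesis using x less.prems(3) by simp
      next
        case y: (2 \<alpha>')
        then show ?thesis
          using x less.prems less.hyps[of \<alpha> \<alpha>'] by (simp add: dyck_h_ge_UD_iff)
      next
        case y: (3 \<alpha>' \<beta>' \<gamma>')
        then show ?thesis
          using x less.prems(3) \<phi>.simps(3)[of \<alpha>' \<beta>' \<gamma>'] by simp
      qed
    next
      case x: (3 \<alpha> \<beta> \<gamma>)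
      note \<phi>x = \<phi>.simps(3)[OF x(1-3), folded x(4)]
      from \<open>dyck y\<close> show ?thesis
      proof (cases rule: dyck_cases)
        case 1
        then show ?thesis using \<phi>x less.prems(3) by simp
      next
        case y: (2 \<alpha>')
        then show ?thesis using \<phi>x less.prems(3) by simp
      next
        case y: (3 \<alpha>' \<beta>' \<gamma>')
        note \<phi>y = \<phi>.simps(3)[OF y(1-3), folded y(4)]
        have eq: "\<phi> (\<alpha> @ \<gamma>) @ U # \<phi> \<beta> = \<phi> (\<alpha>' @ \<gamma>') @ U # \<phi> \<beta>'"
          using \<phi>x \<phi>y less.prems(3) x(1-3) y(1-3) by (simp add: \<phi>_append)
        have "\<phi> (\<alpha> @ \<gamma>) = \<phi> (\<alpha>' @ \<gamma>')" "\<phi> \<beta> = \<phi> \<beta>'"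
          using motzkin_last_return_unique[OF _ _ _ _ eq] x(1-3) y(1-3)
          by (simp_all add: motzkin_\<phi> dyck_append)
        moreover have xs: "\<alpha> @ \<gamma> \<in> dyck_h_ge" "\<beta> \<in> dyck_h_ge"
          "prime_heights_ge (max_height \<beta> + 2) \<alpha>" "max_height \<gamma> < max_height \<beta> + 2"
          using less.prems(1) dyck_h_ge_UUDD_iff[OF x(1-3), folded x(4)] by auto
        moreover have ys: "\<alpha>' @ \<gamma>' \<in> dyck_h_ge" "\<beta>' \<in> dyck_h_ge"
          "prime_heights_ge (max_height \<beta>' + 2) \<alpha>'" "max_height \<gamma>' < max_height \<beta>' + 2"
          using less.prems(2) dyck_h_ge_UUDD_iff[OF y(1-3), folded y(4)] by auto
        ultimately have "\<alpha> @ \<gamma> = \<alpha>' @ \<gamma>'" "\<beta> = \<beta>'"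
          using less.hyps[of "\<alpha> @ \<gamma>" "\<alpha>' @ \<gamma>'"] less.hyps[of \<beta> \<beta>'] x(4) by simp_all
        \<comment> \<open>Since \<open>\<beta> = \<beta>'\<close>, both cuts of the common path use
          the same threshold.\<close>
        moreover have "\<alpha> = \<alpha>' \<and> \<gamma> = \<gamma>'"
          using threshold_split_unique[OF xs(3,4)] ys(3,4) \<open>\<beta> = \<beta>'\<close> \<open>\<alpha> @ \<gamma> = \<alpha>' @ \<gamma>'\<close> by blast
        ultimately show ?thesis using x(4) y(4) by blast
      qed
    qed
  qed
qed

lemma motzkin_in_image_\<phi>: "motzkin w \<Longrightarrow> w \<in> \<phi> ` dyck_h_ge"
proof (induction "length w" arbitrary: w rule: less_induct)
  case less
  from less.prems show ?case
  proof (cases rule: motzkin_cases)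
    case 1
    then show ?thesis using dyck_h_ge.empty by (auto intro: image_eqI[of _ _ "[]"])
  next
    case (2 v)
    then obtain \<alpha> where "\<alpha> \<in> dyck_h_ge" "v = \<phi> \<alpha>" using less.hyps[of v] by auto
    then have "\<alpha> @ [U, D] \<in> dyck_h_ge" "w = \<phi> (\<alpha> @ [U, D])"
      using 2 dyck_h_ge_UD_iff dyck_h_ge_dyck by auto
    then show ?thesis by blast
  next
    case (3 a b)
    obtain \<delta> \<beta> where \<delta>: "\<delta> \<in> dyck_h_ge" "a = \<phi> \<delta>" and \<beta>: "\<beta> \<in> dyck_h_ge" "b = \<phi> \<beta>"
      using less.hyps[of a] less.hyps[of b] 3 by auto
    \<comment> \<open>The preimage \<open>\<delta>\<close> of \<open>a\<close> is to serve as
      \<open>\<alpha> @ \<gamma>\<close>; it is cut at the height that the new last component will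
      have.\<close>
    have "0 < max_height \<beta> + 2" using max_height_nonneg[of \<beta>] by simp
    then obtain \<alpha> \<gamma> where s: "\<delta> = \<alpha> @ \<gamma>" "dyck \<alpha>" "dyck \<gamma>"
      "prime_heights_ge (max_height \<beta> + 2) \<alpha>" "max_height \<gamma> < max_height \<beta> + 2"
      using threshold_split[OF dyck_h_ge_dyck[OF \<delta>(1)] \<delta>(1)] by metis
    let ?P = "\<alpha> @ [U, U] @ \<beta> @ [D] @ \<gamma> @ [D]"
    have "?P \<in> dyck_h_ge"
      using s \<delta> \<beta> dyck_h_ge_UUDD_iff[OF s(2) dyck_h_ge_dyck[OF \<beta>(1)] s(3)] by simp
    moreover have "w = \<phi> ?P"
      using \<phi>.simps(3)[OF s(2) dyck_h_ge_dyck[OF \<beta>(1)] s(3)] s(1-3) \<delta> \<beta> 3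
      by (simp add: \<phi>_append)
    ultimately show ?thesis by blast
  qed
qed

theorem theorem1:
  fixes n :: nat
  shows "bij_betw \<phi> (dyck_h_ge_paths n) (motzkin_paths n) \<and>
    (\<forall>P \<in> dyck_h_ge_paths n.
      occ [U, D] P = occ [F] (\<phi> P) + occ [U, D] (\<phi> P) \<and>
      occ [U, U] P = occ [D, D] P \<and>
      occ [D, D] P = occ [U] (\<phi> P) + occ [U, U] (\<phi> P) + occ [U, F] (\<phi> P) \<and>
      occ [D, U] P = occ [F, F] (\<phi> P) + occ [F, U] (\<phi> P) + occ [D, F] (\<phi> P) + occ [D, U] (\<phi> P))"
proof (intro conjI ballI)
  have "inj_on \<phi> (dyck_h_ge_paths n)"
    using inj_on_\<phi> by (rule inj_on_subset) (auto simp: dyck_h_ge_paths_def)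
  \<comment> \<open>\<open>\<phi>\<close> halves lengths, so the bijection between all paths
    restricts to semilength \<open>n\<close> and length \<open>n\<close>.\<close>
  moreover have "\<phi> ` dyck_h_ge_paths n = motzkin_paths n"
  proof (intro equalityI subsetI)
    fix m
    assume "m \<in> \<phi> ` dyck_h_ge_paths n"
    then show "m \<in> motzkin_paths n"
      using dyck_h_ge_dyck motzkin_\<phi> length_\<phi>
      by (fastforce simp: dyck_h_ge_paths_def motzkin_paths_def)
  next
    fix m
    assume "m \<in> motzkin_paths n"
    then obtain P where "P \<in> dyck_h_ge" "m = \<phi> P" "length m = n"
      using motzkin_in_image_\<phi> by (auto simp: motzkin_paths_def)
    then show "m \<in> \<phi> ` dyck_h_ge_paths n"
      using length_\<phi>[OF dyck_h_ge_dyck] by (force simp: dyck_h_ge_paths_def)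
  qed
  ultimately show "bij_betw \<phi> (dyck_h_ge_paths n) (motzkin_paths n)"
    by (simp add: bij_betw_def)
qed (use occ_\<phi> dyck_h_ge_dyck in \<open>auto simp: dyck_h_ge_paths_def\<close>)

end
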